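(* Consider a single-layer deep exponential family model with joint density $p(\bm x,\bm y)=\big[\prod_{j=1}^m p(y_j)\big]\big[\prod_{i=1}^n p(x_i\mid \bm y)\big]$, $\bm x\in\mathbb R^n$, $\bm y\in\mathbb R^m$, where $p(x_i\mid\bm y)=\exp\{g(x_i)+t(x_i)\eta_i(\bm y)-a(\eta_i(\bm y))\}$ and $\eta_i(\bm y)=b_i+\bm w_i\cdot\bm y$ with $b_i\in\mathbb R$, $\bm w_i=(w_{i1},\dots,w_{im})\in\mathbb R^m$. Let $\bm x$ be an observation, let $q(\bm y\mid\bm x)=\prod_{j=1}^m q(y_j\mid\bm x)$ be a mean-field variational distribution, and for each $i$ let $\bm\varepsilon_i=(\varepsilon_{i1},\dots,\varepsilon_{im})$ and $\hat{\bm b}_i=(\hat b_{i1},\dots,\hat b_{im})\in\mathbb R^m$ be auxiliary parameters with $\varepsilon_{ij}\ge 0$ for all $j$, $\sum_{j=1}^m\varepsilon_{ij}=1$ and $\sum_{j=1}^m\varepsilon_{ij}\hat b_{ij}=b_i$. Define $$\hat\eta_{ij}=\hat b_{ij}+\frac{w_{ij}y_j}{\varepsilon_{ij}},\qquad \hat p(x_i\mid y_j)=\exp\{g(x_i)+t(x_i)\hat\eta_{ij}-a(\hat\eta_{ij})\}.$$ Then $$\log p(\bm x)\;\ge\;\mathbb E[\log p(\bm x,\bm y)]+H(\bm y\mid\bm x)\;\ge\;\sum_{i=1}^n\sum_{j=1}^m\varepsilon_{ij}\,\mathbb E[\log\hat p(x_i\mid y_j)]-\sum_{j=1}^m D_{KL}\big(q(y_j\mid\bm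 x)\,\|\,p(y_j)\big).$$
   Context: An exponential family of densities has the form $p(x)=\exp\{g(x)+t(x)\eta-a(\eta)\}$, where $g$ is the log-base measure, $t$ the sufficient statistic, $\eta$ the natural parameter and $a$ the log-partition function, which is convex. The variables $\bm x$ are observed and $\bm y$ latent; $p(\bm x)=\int p(\bm x,\bm y)\,d\bm y$. Expectations and the conditional entropy $H(\bm y\mid\bm x)$ are taken with respect to the variational distribution $q(\bm y\mid\bm x)$; $D_{KL}$ is the Kullback–Leibler divergence. The last expression is called the forest mixture (FM) bound.
   Formalization: It is assumed that w_ij = 0 whenever ε_ij = 0 (otherwise w_ij y_j/ε_ij is undefined), that the η̂_ij with ε_ij > 0 are valid natural parameters q-almost surely, and that p(x), the expectations, the entropy and the KL divergences are finite. *)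

theory Defs
  imports "HOL-Probability.Probability"
begin

text \<open>
  A one-parameter exponential family on the reals. Its densities are taken with respect to a
  reference measure \<open>\<mu>\<close> (Lebesgue or counting measure on a countable set, for instance);
  \<open>g\<close> is the log-base measure, \<open>t\<close> the sufficient statistic. Convexity of the log-partition
  function is not a hypothesis anywhere: it follows from the definition.
\<close>

definition exp_family :: "real measure \<Rightarrow> (real \<Rightarrow> real) \<Rightarrow> (real \<Rightarrow> real) \<Rightarrow> bool" where
  "exp_family \<mu> g t \<longleftrightarrow>
     sets \<mu> = sets borel \<and> sigma_finite_measure \<mu> \<and> emeasure \<mu> (space \<mu>) \<noteq> 0 \<and>
     g \<in> borel_measurable borel \<and> t \<in> borel_measurable borel"

definition natural_params :: "real measure \<Rightarrow> (real \<Rightarrow> real) \<Rightarrow> (real \<Rightarrow> real) \<Rightarrow> real set" where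
  "natural_params \<mu> g t = {\<eta>. integrable \<mu> (\<lambda>x. exp (g x + t x * \<eta>))}"

definition log_partition :: "real measure \<Rightarrow> (real \<Rightarrow> real) \<Rightarrow> (real \<Rightarrow> real) \<Rightarrow> real \<Rightarrow> real" where
  "log_partition \<mu> g t \<eta> = ln (\<integral>x. exp (g x + t x * \<eta>) \<partial>\<mu>)"

definition expfam_density ::
    "real measure \<Rightarrow> (real \<Rightarrow> real) \<Rightarrow> (real \<Rightarrow> real) \<Rightarrow> real \<Rightarrow> real \<Rightarrow> real" where
  "expfam_density \<mu> g t \<eta> x = exp (g x + t x * \<eta> - log_partition \<mu> g t \<eta>)"

lemma prob_space_expfam_density:
  assumes "exp_family \<mu> g t" "\<eta> \<in> natural_params \<mu> g t"
  shows "prob_space (density \<mu> (\<lambda>x. ennreal (expfam_density \<mu> g t \<eta> x)))"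
proof -
  have sets[measurable_cong]: "sets \<mu> = sets borel" and nz: "emeasure \<mu> (space \<mu>) \<noteq> 0"
    and [measurable]: "g \<in> borel_measurable borel" "t \<in> borel_measurable borel"
    using assms(1) by (auto simp: exp_family_def)
  let ?f = "\<lambda>x. exp (g x + t x * \<eta>)"
  have int: "integrable \<mu> ?f"
    using assms(2) by (simp add: natural_params_def)
  have "integral\<^sup>L \<mu> ?f \<noteq> 0"
  proof
    assume "integral\<^sup>L \<mu> ?f = 0"
    then have "AE x in \<mu>. ?f x = 0"
      using integral_nonneg_eq_0_iff_AE[OF int] by simp
    then have "AE x in \<mu>. False" by simp
    then show False using nz
      by (auto simp: AE_iff_measurable[OF sets.top[of \<mu>], where P = "\<lambda>_. False"])
  qed
  moreover have "integral\<^sup>L \<mu> ?f \<ge> 0" by simp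
  ultimately have pos: "integral\<^sup>L \<mu> ?f > 0" by linarith
  have eq: "expfam_density \<mu> g t \<eta> x = ?f x / integral\<^sup>L \<mu> ?f" for x
    using pos by (simp add: expfam_density_def log_partition_def exp_diff)
  have "(\<integral>\<^sup>+x. ennreal (expfam_density \<mu> g t \<eta> x) \<partial>\<mu>) = ennreal (\<integral>x. ?f x / integral\<^sup>L \<mu> ?f \<partial>\<mu>)"
    unfolding eq using int pos by (intro nn_integral_eq_integral) auto
  also have "\<dots> = 1" using pos by simp
  finally have one: "(\<integral>\<^sup>+x. ennreal (expfam_density \<mu> g t \<eta> x) \<partial>\<mu>) = 1" .
  have [measurable]: "expfam_density \<mu> g t \<eta> \<in> borel_measurable \<mu>"
    unfolding expfam_density_def[abs_def] by measurable
  show ?thesis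
    by (rule prob_spaceI) (simp add: emeasure_density one cong: nn_integral_cong)
qed

definition prob_density :: "real measure \<Rightarrow> (real \<Rightarrow> real) \<Rightarrow> bool" where
  "prob_density \<nu> f \<longleftrightarrow>
     f \<in> borel_measurable borel \<and> (\<forall>u. 0 \<le> f u) \<and> (\<integral>\<^sup>+u. ennreal (f u) \<partial>\<nu>) = 1"

text \<open>
  Vectors in \<open>\<real>\<^sup>m\<close> are functions on a finite index type, and \<open>d\<^bold>y\<close> is the product of the coordinate
  reference measures \<open>\<nu> j\<close>; for \<open>\<nu> j = lborel\<close> this is Lebesgue measure on \<open>\<real>\<^sup>m\<close>.
\<close>

definition ref_measure :: "('m::finite \<Rightarrow> real measure) \<Rightarrow> ('m \<Rightarrow> real) measure" where
  "ref_measure \<nu> = Pi\<^sub>M UNIV \<nu>"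

definition prod_density :: "('m::finite \<Rightarrow> real \<Rightarrow> real) \<Rightarrow> ('m \<Rightarrow> real) \<Rightarrow> real" where
  "prod_density f y = (\<Prod>j\<in>UNIV. f j (y j))"

definition prod_law ::
    "('m::finite \<Rightarrow> real measure) \<Rightarrow> ('m \<Rightarrow> real \<Rightarrow> real) \<Rightarrow> ('m \<Rightarrow> real) measure" where
  "prod_law \<nu> f = density (ref_measure \<nu>) (\<lambda>y. ennreal (prod_density f y))"

definition coord_law ::
    "('m \<Rightarrow> real measure) \<Rightarrow> ('m \<Rightarrow> real \<Rightarrow> real) \<Rightarrow> 'm \<Rightarrow> real measure" where
  "coord_law \<nu> f j = density (\<nu> j) (\<lambda>u. ennreal (f j u))"

definition nat_param :: "real \<Rightarrow> ('m::finite \<Rightarrow> real) \<Rightarrow> ('m \<Rightarrow> real) \<Rightarrow> real" where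
  "nat_param b w y = b + (\<Sum>j\<in>UNIV. w j * y j)"

definition joint_density ::
    "real measure \<Rightarrow> (real \<Rightarrow> real) \<Rightarrow> (real \<Rightarrow> real) \<Rightarrow> ('m::finite \<Rightarrow> real \<Rightarrow> real) \<Rightarrow>
     ('n::finite \<Rightarrow> real) \<Rightarrow> ('n \<Rightarrow> 'm \<Rightarrow> real) \<Rightarrow> ('n \<Rightarrow> real) \<Rightarrow> ('m \<Rightarrow> real) \<Rightarrow> real" where
  "joint_density \<mu> g t p b w x y =
     (\<Prod>j\<in>UNIV. p j (y j)) * (\<Prod>i\<in>UNIV. expfam_density \<mu> g t (nat_param (b i) (w i) y) (x i))"

definition marginal_density ::
    "real measure \<Rightarrow> (real \<Rightarrow> real) \<Rightarrow> (real \<Rightarrow> real) \<Rightarrow> ('m::finite \<Rightarrow> real measure) \<Rightarrow>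
     ('m \<Rightarrow> real \<Rightarrow> real) \<Rightarrow> ('n::finite \<Rightarrow> real) \<Rightarrow> ('n \<Rightarrow> 'm \<Rightarrow> real) \<Rightarrow> ('n \<Rightarrow> real) \<Rightarrow> real" where
  "marginal_density \<mu> g t \<nu> p b w x = (\<integral>y. joint_density \<mu> g t p b w x y \<partial>ref_measure \<nu>)"

text \<open>
  If \<open>\<epsilon> = 0\<close> then \<open>w * u / \<epsilon>\<close> is \<open>0\<close> here, so this is the intended quantity only if
  \<open>\<epsilon> = 0\<close> implies \<open>w = 0\<close>.
\<close>

definition aux_param :: "real \<Rightarrow> real \<Rightarrow> real \<Rightarrow> real \<Rightarrow> real" where
  "aux_param bh w \<epsilon> u = bh + w * u / \<epsilon>"

end

theory Submission
  imports Defs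
begin

text \<open>
  The evidence bound is \<open>ln z \<le> z - 1\<close> applied to \<open>z = p(x,y) / (q(y) p(x))\<close> and integrated against
  \<open>q\<close>. For the forest mixture bound, the constraints on \<open>\<epsilon>\<close> and \<open>bh\<close> make the natural parameter
  \<open>\<eta>\<^sub>i(y)\<close> the convex combination of the auxiliary parameters with weights \<open>\<epsilon> i j\<close>, so convexity of the
  log-partition function bounds each conditional log-likelihood below by the mixture of auxiliary
  ones. The prior and entropy terms combine to the KL divergences because both laws factorise over
  the coordinates.
\<close>

section \<open>Convexity of the log-partition function\<close>

text \<open>Inverting the \<open>ln\<close> in \<open>log_partition\<close> requires a positive
  integral. This is read off the normalised density having total mass one.\<close>

lemma integral_exp_eq_exp_log_partition:
  assumes fam: "exp_family \<mu> g t" and \<eta>: "\<eta> \<in> natural_params \<mu> g t"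
  shows "(\<integral>x. exp (g x + t x * \<eta>) \<partial>\<mu>) = exp (log_partition \<mu> g t \<eta>)"
proof -
  interpret P: prob_space "density \<mu> (\<lambda>x. ennreal (expfam_density \<mu> g t \<eta> x))"
    by (rule prob_space_expfam_density[OF fam \<eta>])
  have [measurable_cong]: "sets \<mu> = sets borel"
    and [measurable]: "g \<in> borel_measurable borel" "t \<in> borel_measurable borel"
    using fam by (auto simp: exp_family_def)
  have [measurable]: "expfam_density \<mu> g t \<eta> \<in> borel_measurable \<mu>"
    unfolding expfam_density_def[abs_def] by measurable
  have "(\<integral>x. expfam_density \<mu> g t \<eta> x \<partial>\<mu>)
          = integral\<^sup>L (density \<mu> (\<lambda>x. ennreal (expfam_density \<mu> g t \<eta> x))) (\<lambda>_. 1)"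
    by (subst integral_real_density) (auto simp: expfam_density_def[abs_def])
  also have "\<dots> = 1"
    using P.prob_space by simp
  finally have "(\<integral>x. exp (g x + t x * \<eta>) / exp (log_partition \<mu> g t \<eta>) \<partial>\<mu>) = 1"
    unfolding expfam_density_def exp_diff .
  then show ?thesis by simp
qed

text \<open>This is Hoelder's inequality in the form of its usual proof: normalise both exponentials
  to have integral one, apply convexity of \<open>exp\<close> pointwise, then integrate.\<close>

lemma convex_on_log_partition:
  assumes fam: "exp_family \<mu> g t"
  shows "convex_on (natural_params \<mu> g t) (log_partition \<mu> g t)"
proof -
  have [measurable_cong]: "sets \<mu> = sets borel"
    and [measurable]: "g \<in> borel_measurable borel" "t \<in> borel_measurable borel"
    using fam by (auto simp: exp_family_def)
  let ?a = "log_partition \<mu> g t"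
  have AM_GM: "exp (u * r + v * s) \<le> u * exp r + v * exp s"
    if "0 \<le> u" "0 \<le> v" "u + v = 1" for u v r s :: real
    using exp_convex that by (auto simp: convex_on_def)
  \<comment> \<open>The set of natural parameters is convex: the mixture of the two integrable
    exponentials dominates the exponential at the intermediate parameter.\<close>
  have int: "integrable \<mu> (\<lambda>x. exp (g x + t x * (u * \<eta> + v * \<eta>')))"
    if "0 \<le> u" "0 \<le> v" "u + v = 1" "\<eta> \<in> natural_params \<mu> g t" "\<eta>' \<in> natural_params \<mu> g t"
    for u v \<eta> \<eta>'
  proof (rule Bochner_Integration.integrable_bound)
    show "integrable \<mu> (\<lambda>x. u * exp (g x + t x * \<eta>) + v * exp (g x + t x * \<eta>'))"
      using that by (simp add: natural_params_def)
    have "exp (g x + t x * (u * \<eta> + v * \<eta>')) \<le> u * exp (g x + t x * \<eta>) + v * exp (g x + t x * \<eta>')"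
      for x
    proof -
      have "g x + t x * (u * \<eta> + v * \<eta>') = u * (g x + t x * \<eta>) + v * (g x + t x * \<eta>')"
        using that(3) by (simp add: algebra_simps flip: distrib_left)
           (metis distrib_right mult.commute mult_1)
      then show ?thesis using AM_GM[OF that(1-3)] by metis
    qed
    then show "AE x in \<mu>. norm (exp (g x + t x * (u * \<eta> + v * \<eta>')))
        \<le> norm (u * exp (g x + t x * \<eta>) + v * exp (g x + t x * \<eta>'))"
      using that by (intro AE_I2) (smt (verit) exp_ge_zero real_norm_def)
  qed measurable
  show ?thesis
    unfolding convex_on_def
  proof (intro conjI ballI allI impI)
    show "convex (natural_params \<mu> g t)"
      using int by (auto simp: convex_def natural_params_def)
  next
    fix \<eta> \<eta>' u v :: real
    assume \<eta>: "\<eta> \<in> natural_params \<mu> g t" "\<eta>' \<in> natural_params \<mu> g t"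
      and uv: "0 \<le> u" "0 \<le> v" "u + v = 1"
    let ?\<theta> = "u * \<eta> + v * \<eta>'" and ?c = "u * ?a \<eta> + v * ?a \<eta>'"
    have \<theta>: "?\<theta> \<in> natural_params \<mu> g t"
      using int[OF uv \<eta>] by (simp add: natural_params_def)
    have dens_int: "integrable \<mu> (\<lambda>x. exp (g x + t x * r - ?a r))"
      and dens: "(\<integral>x. exp (g x + t x * r - ?a r) \<partial>\<mu>) = 1" if "r \<in> natural_params \<mu> g t" for r
      using integral_exp_eq_exp_log_partition[OF fam that] that
      by (auto simp: natural_params_def exp_diff)
    \<comment> \<open>Subtracting \<open>?c\<close> splits, with \<open>u + v = 1\<close>, into
      subtracting the matching log-partition value in each exponent, so both terms on the right are
      densities and the right side integrates to \<open>u + v\<close>.\<close>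
    have le: "exp (g x + t x * ?\<theta> - ?c)
        \<le> u * exp (g x + t x * \<eta> - ?a \<eta>) + v * exp (g x + t x * \<eta>' - ?a \<eta>')" for x
    proof -
      have "g x + t x * ?\<theta> - ?c = (u + v) * g x + t x * ?\<theta> - ?c"
        using uv(3) by simp
      also have "\<dots> = u * (g x + t x * \<eta> - ?a \<eta>) + v * (g x + t x * \<eta>' - ?a \<eta>')"
        by (simp add: algebra_simps)
      finally show ?thesis using AM_GM[OF uv] by metis
    qed
    have "exp (?a ?\<theta> - ?c) = (\<integral>x. exp (g x + t x * ?\<theta> - ?c) \<partial>\<mu>)"
      using integral_exp_eq_exp_log_partition[OF fam \<theta>] by (simp add: exp_diff)
    also have "\<dots> \<le> (\<integral>x. u * exp (g x + t x * \<eta> - ?a \<eta>) + v * exp (g x + t x * \<eta>' - ?a \<eta>') \<partial>\<mu>)"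
      using dens_int[OF \<theta>] int[OF uv \<eta>]
      by (intro integral_mono le Bochner_Integration.integrable_add integrable_mult_right dens_int \<eta>)
         (simp add: exp_diff)
    also have "\<dots> = 1"
      using dens_int dens \<eta> uv(3) by simp
    finally show "?a (u *\<^sub>R \<eta> + v *\<^sub>R \<eta>') \<le> u * ?a \<eta> + v * ?a \<eta>'"
      by simp
  qed
qed

section \<open>Natural parameters as mixtures of auxiliary parameters\<close>

text \<open>Each weight cancels the division in its own auxiliary parameter. Where the weight is
  zero, both \<open>w j * y j\<close> and the weighted term vanish, so the value chosen for division
  by zero does no harm.\<close>

lemma nat_param_eq_sum_aux_param:
  assumes "(\<Sum>j\<in>UNIV. \<epsilon> j * bh j) = b" and "\<And>j. \<epsilon> j = 0 \<Longrightarrow> w j = 0"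
  shows "nat_param b w y = (\<Sum>j\<in>UNIV. \<epsilon> j * aux_param (bh j) (w j) (\<epsilon> j) (y j))"
proof -
  have "\<epsilon> j * aux_param (bh j) (w j) (\<epsilon> j) (y j) = \<epsilon> j * bh j + w j * y j" for j
    using assms(2)[of j] by (cases "\<epsilon> j = 0") (auto simp: aux_param_def field_simps)
  then show ?thesis
    using assms(1) by (simp add: nat_param_def sum.distrib)
qed

text \<open>Jensen's inequality: for fixed \<open>x\<close> the log-density is affine in the natural
  parameter minus a convex function, hence concave.\<close>

lemma ln_expfam_density_sum_ge:
  fixes \<epsilon> \<theta> :: "'m::finite \<Rightarrow> real"
  assumes fam: "exp_family \<mu> g t"
    and \<epsilon>: "\<And>j. 0 \<le> \<epsilon> j" "(\<Sum>j\<in>UNIV. \<epsilon> j) = 1"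
    and \<theta>: "\<And>j. 0 < \<epsilon> j \<Longrightarrow> \<theta> j \<in> natural_params \<mu> g t"
  shows "(\<Sum>j\<in>UNIV. \<epsilon> j * ln (expfam_density \<mu> g t (\<theta> j) x))
           \<le> ln (expfam_density \<mu> g t (\<Sum>j\<in>UNIV. \<epsilon> j * \<theta> j) x)"
proof -
  let ?a = "log_partition \<mu> g t" and ?S = "{j. 0 < \<epsilon> j}"
  \<comment> \<open>Jensen is applied on the support of the weights, since a parameter of weight
    zero may lie outside \<open>natural_params\<close>.\<close>
  have supp: "(\<Sum>j\<in>UNIV. \<epsilon> j * f j) = (\<Sum>j\<in>?S. \<epsilon> j * f j)" for f
    using \<epsilon>(1) by (intro sum.mono_neutral_right) (auto simp: less_le)
  have "sum \<epsilon> ?S = 1"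
    using supp[of "\<lambda>_. 1"] \<epsilon>(2) by simp
  then have "?S \<noteq> {}"
    by (metis sum.empty zero_neq_one)
  then have "?a (\<Sum>j\<in>?S. \<epsilon> j *\<^sub>R \<theta> j) \<le> (\<Sum>j\<in>?S. \<epsilon> j * ?a (\<theta> j))"
    using supp[of "\<lambda>_. 1"] \<epsilon> \<theta>
    by (intro convex_on_sum[OF _ _ convex_on_log_partition[OF fam]]) auto
  then have *: "?a (\<Sum>j\<in>UNIV. \<epsilon> j * \<theta> j) \<le> (\<Sum>j\<in>UNIV. \<epsilon> j * ?a (\<theta> j))"
    by (simp add: supp)
  have "(\<Sum>j\<in>UNIV. \<epsilon> j * (g x + t x * \<theta> j - ?a (\<theta> j)))
      = (\<Sum>j\<in>UNIV. \<epsilon> j) * g x + t x * (\<Sum>j\<in>UNIV. \<epsilon> j * \<theta> j) - (\<Sum>j\<in>UNIV. \<epsilon> j * ?a (\<theta> j))"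
    by (simp add: algebra_simps sum.distrib sum_subtractf sum_distrib_left sum_distrib_right)
  then show ?thesis
    using * \<epsilon>(2) by (simp add: expfam_density_def)
qed

section \<open>The evidence lower bound\<close>

text \<open>Stated for an arbitrary measure: \<open>f\<close> stands for the variational density and
  \<open>h\<close> for the unnormalised joint density, whose total mass is the evidence.\<close>

lemma evidence_lower_bound:
  fixes f h :: "'a \<Rightarrow> real"
  assumes prob: "prob_space (density M (\<lambda>y. ennreal (f y)))"
    and [measurable]: "f \<in> borel_measurable M" and f_nonneg: "\<And>y. 0 \<le> f y"
    and h_int: "integrable M h" and h_nonneg: "\<And>y. 0 \<le> h y"
    and h_pos: "AE y in density M (\<lambda>y. ennreal (f y)). 0 < h y"
    and ln_h: "integrable (density M (\<lambda>y. ennreal (f y))) (\<lambda>y. ln (h y))"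
    and ln_f: "integrable (density M (\<lambda>y. ennreal (f y))) (\<lambda>y. ln (f y))"
  shows "(\<integral>y. ln (h y) \<partial>density M (\<lambda>y. ennreal (f y)))
           - (\<integral>y. ln (f y) \<partial>density M (\<lambda>y. ennreal (f y))) \<le> ln (\<integral>y. h y \<partial>M)"
proof -
  let ?Q = "density M (\<lambda>y. ennreal (f y))" and ?Z = "\<integral>y. h y \<partial>M"
  interpret Q: prob_space ?Q by fact
  have [measurable]: "h \<in> borel_measurable M"
    using h_int by simp
  \<comment> \<open>Zero mass would make \<open>h\<close> vanish almost everywhere for
    \<open>M\<close>, hence for \<open>?Q\<close>, against \<open>h_pos\<close>.\<close>
  have "?Z \<noteq> 0"
  proof
    assume "?Z = 0"
    then have "AE y in M. h y = 0"
      using integral_nonneg_eq_0_iff_AE[OF h_int] h_nonneg by simp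
    then have "AE y in ?Q. h y = 0"
      by (subst AE_density) auto
    with h_pos have "AE y in ?Q. False"
      by eventually_elim simp
    then show False by simp
  qed
  then have Z: "0 < ?Z"
    using Bochner_Integration.integral_nonneg[of M h] h_nonneg by (simp add: less_le)
  have f_pos: "AE y in ?Q. 0 < f y"
    by (subst AE_density) auto
  have ratio_int: "integrable M (\<lambda>y. f y * (h y / (f y * ?Z)))"
    by (rule Bochner_Integration.integrable_bound[OF integrable_divide[OF h_int, of ?Z]])
       (use Z h_nonneg in \<open>auto simp: divide_simps\<close>)
  have ratio_intQ: "integrable ?Q (\<lambda>y. h y / (f y * ?Z))"
    using ratio_int f_nonneg by (subst integrable_real_density) auto
  have ratio_le: "(\<integral>y. h y / (f y * ?Z) \<partial>?Q) \<le> 1"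
  proof -
    have "(\<integral>y. h y / (f y * ?Z) \<partial>?Q) = (\<integral>y. f y * (h y / (f y * ?Z)) \<partial>M)"
      using f_nonneg by (subst integral_real_density) auto
    \<comment> \<open>Only an inequality: where \<open>f\<close> is zero the left integrand is zero,
      while \<open>h\<close> may still carry mass there.\<close>
    also have "\<dots> \<le> (\<integral>y. h y / ?Z \<partial>M)"
      using ratio_int h_int Z h_nonneg by (intro integral_mono) (auto simp: divide_simps)
    also have "\<dots> = 1" using Z by simp
    finally show ?thesis .
  qed
  have "(\<integral>y. ln (h y) - ln (f y) - ln ?Z \<partial>?Q) \<le> (\<integral>y. h y / (f y * ?Z) - 1 \<partial>?Q)"
  proof (rule integral_mono_AE)
    show "AE y in ?Q. ln (h y) - ln (f y) - ln ?Z \<le> h y / (f y * ?Z) - 1"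
      using h_pos f_pos
    proof eventually_elim
      case (elim y)
      then have "ln (h y) - ln (f y) - ln ?Z = ln (h y / (f y * ?Z))"
        using Z by (simp add: ln_div ln_mult)
      then show ?case
        using ln_le_minus_one[of "h y / (f y * ?Z)"] elim Z by simp
    qed
  qed (use ln_h ln_f ratio_intQ in auto)
  then show ?thesis
    using ratio_le ln_h ln_f ratio_intQ Q.prob_space by simp
qed

section \<open>Factorised laws and their coordinates\<close>

lemma prob_space_coord_law:
  assumes "sets (\<nu> j) = sets borel" "prob_density (\<nu> j) (f j)"
  shows "prob_space (coord_law \<nu> f j)"
proof -
  have [measurable_cong]: "sets (\<nu> j) = sets borel" by fact
  have [measurable]: "f j \<in> borel_measurable borel"
    using assms(2) by (simp add: prob_density_def)
  show ?thesis
    using assms(2)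
    by (intro prob_spaceI) (simp add: coord_law_def prob_density_def emeasure_density cong: nn_integral_cong)
qed

lemma measurable_prod_density:
  fixes \<nu> :: "'m::finite \<Rightarrow> real measure"
  assumes "\<And>j. sets (\<nu> j) = sets borel" "\<And>j. f j \<in> borel_measurable borel"
  shows "prod_density f \<in> borel_measurable (ref_measure \<nu>)"
proof -
  note assms(1)[measurable_cong] assms(2)[measurable]
  show ?thesis unfolding prod_density_def[abs_def] ref_measure_def by measurable
qed

text \<open>It suffices to compare the two measures on boxes, where the integral of a product of
  one-variable functions factorises.\<close>

lemma prod_law_eq_PiM:
  fixes \<nu> :: "'m::finite \<Rightarrow> real measure"
  assumes sets: "\<And>j. sets (\<nu> j) = sets borel" and sf: "\<And>j. sigma_finite_measure (\<nu> j)"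
    and f: "\<And>j. prob_density (\<nu> j) (f j)"
  shows "prod_law \<nu> f = Pi\<^sub>M UNIV (coord_law \<nu> f)"
proof -
  note sets[measurable_cong]
  have [measurable]: "f j \<in> borel_measurable borel" for j
    using f by (simp add: prob_density_def)
  have f_nonneg: "0 \<le> f j u" for j u
    using f by (simp add: prob_density_def)
  interpret N: product_sigma_finite \<nu>
    by (simp add: product_sigma_finite_def sf)
  interpret C: product_prob_space "coord_law \<nu> f" UNIV
    by (intro product_prob_spaceI prob_space_coord_law sets f)
  note measurable_prod_density[of \<nu> f, OF sets, measurable]
  show ?thesis
  proof (rule C.PiM_eqI)
    show "sets (prod_law \<nu> f) = sets (Pi\<^sub>M UNIV (coord_law \<nu> f))"
      unfolding prod_law_def ref_measure_def sets_density
      by (rule sets_PiM_cong) (auto simp: coord_law_def)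
  next
    fix A assume "\<And>j. j \<in> UNIV \<Longrightarrow> A j \<in> sets (coord_law \<nu> f j)"
    then have A[measurable]: "A j \<in> sets (\<nu> j)" for j
      by (simp add: coord_law_def)
    have [measurable]: "Pi\<^sub>E UNIV A \<in> sets (ref_measure \<nu>)"
      unfolding ref_measure_def using A by (intro sets_PiM_I_finite) auto
    \<comment> \<open>Written as a product, the indicator of the box merges with the density
      coordinate by coordinate.\<close>
    have box: "indicator (Pi\<^sub>E UNIV A) y = (\<Prod>j\<in>UNIV. indicator (A j) (y j) :: ennreal)" for y
      by (cases "\<forall>j. y j \<in> A j") (auto simp: PiE_UNIV_domain Pi_iff intro!: prod_zero[symmetric] intro: indicator_simps(2))
    have "emeasure (prod_law \<nu> f) (Pi\<^sub>E UNIV A)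
        = (\<integral>\<^sup>+y. (\<Prod>j\<in>UNIV. ennreal (f j (y j)) * indicator (A j) (y j)) \<partial>Pi\<^sub>M UNIV \<nu>)"
      unfolding prod_law_def
      by (subst emeasure_density, measurable)
         (simp add: ref_measure_def prod_density_def prod_ennreal f_nonneg prod.distrib box)
    also have "\<dots> = (\<Prod>j\<in>UNIV. emeasure (coord_law \<nu> f j) (A j))"
      by (subst N.product_nn_integral_prod) (auto simp: coord_law_def emeasure_density)
    finally show "emeasure (prod_law \<nu> f) (Pi\<^sub>E UNIV A) = (\<Prod>j\<in>UNIV. emeasure (coord_law \<nu> f j) (A j))" .
  qed simp
qed

lemma distr_prod_law_component:
  fixes \<nu> :: "'m::finite \<Rightarrow> real measure"
  assumes "\<And>j. sets (\<nu> j) = sets borel" "\<And>j. sigma_finite_measure (\<nu> j)" "\<And>j. prob_density (\<nu> j) (f j)"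
  shows "distr (prod_law \<nu> f) (coord_law \<nu> f j) (\<lambda>y. y j) = coord_law \<nu> f j"
  unfolding prod_law_eq_PiM[OF assms]
  by (rule distr_PiM_component) (simp_all add: prob_space_coord_law assms)

lemma measurable_prod_law_component:
  fixes \<nu> :: "'m::finite \<Rightarrow> real measure"
  assumes "\<And>j. sets (\<nu> j) = sets borel" "\<And>j. sigma_finite_measure (\<nu> j)" "\<And>j. prob_density (\<nu> j) (f j)"
  shows "(\<lambda>y. y j) \<in> measurable (prod_law \<nu> f) (coord_law \<nu> f j)"
  unfolding prod_law_eq_PiM[OF assms] by measurable

section \<open>KL divergence and entropy in terms of densities\<close>

lemma AE_coord_law_pos:
  assumes "f j \<in> borel_measurable (\<nu> j)"
  shows "AE u in coord_law \<nu> f j. 0 < f j u"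
  using assms unfolding coord_law_def by (subst AE_density) auto

text \<open>\<open>entropy_density\<close> is the logarithm of a Radon-Nikodym derivative. By
  absolute continuity the ratio \<open>q j u / p j u\<close> is such a derivative; uniqueness holds
  almost everywhere for the prior, and absolute continuity carries it over to the variational
  law.\<close>

lemma AE_entropy_density_coord_law:
  fixes \<nu> :: "'m \<Rightarrow> real measure"
  assumes sets: "sets (\<nu> j) = sets borel"
    and p: "prob_density (\<nu> j) (p j)" and q: "prob_density (\<nu> j) (q j)"
    and ac: "absolutely_continuous (coord_law \<nu> p j) (coord_law \<nu> q j)"
  shows "AE u in coord_law \<nu> q j. 0 < p j u \<and> 0 < q j u \<and>
           entropy_density (exp 1) (coord_law \<nu> p j) (coord_law \<nu> q j) u = ln (q j u) - ln (p j u)"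
proof -
  note sets[measurable_cong]
  have [measurable]: "p j \<in> borel_measurable borel" "q j \<in> borel_measurable borel"
    and p_nonneg: "0 \<le> p j u" and q_nonneg: "0 \<le> q j u" for u
    using p q by (auto simp: prob_density_def)
  interpret P: prob_space "coord_law \<nu> p j"
    by (rule prob_space_coord_law[of \<nu> j p, OF sets p])
  have sets_eq: "sets (coord_law \<nu> q j) = sets (coord_law \<nu> p j)"
    by (simp add: coord_law_def)
  have p_pos: "AE u in coord_law \<nu> q j. 0 < p j u"
    by (rule absolutely_continuous_AE[OF sets_eq ac AE_coord_law_pos]) measurable
  have q_pos: "AE u in coord_law \<nu> q j. 0 < q j u"
    by (rule AE_coord_law_pos) measurable
  \<comment> \<open>Back on the reference measure, this makes \<open>p * (q / p) = q\<close> almost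
    everywhere, including where \<open>p\<close> vanishes.\<close>
  have p0: "AE u in \<nu> j. 0 < q j u \<longrightarrow> 0 < p j u"
    using p_pos unfolding coord_law_def by (subst (asm) AE_density) auto
  have "density (coord_law \<nu> p j) (\<lambda>u. ennreal (q j u / p j u)) = coord_law \<nu> q j"
    unfolding coord_law_def
  proof (subst density_density_eq, measurable, rule density_cong)
    show "AE u in \<nu> j. ennreal (p j u) * ennreal (q j u / p j u) = ennreal (q j u)"
      using p0
    proof eventually_elim
      case (elim u)
      then show ?case
        using p_nonneg[of u] q_nonneg[of u]
        by (cases "q j u = 0") (auto simp: ennreal_mult[symmetric] less_le)
    qed
  qed measurable
  then have "AE u in coord_law \<nu> p j.
      ennreal (q j u / p j u) = RN_deriv (coord_law \<nu> p j) (coord_law \<nu> q j) u"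
    by (intro P.RN_deriv_unique) (auto simp: coord_law_def)
  then have "AE u in coord_law \<nu> q j.
      ennreal (q j u / p j u) = RN_deriv (coord_law \<nu> p j) (coord_law \<nu> q j) u"
    by (rule absolutely_continuous_AE[OF sets_eq ac])
  with p_pos q_pos show ?thesis
  proof eventually_elim
    case (elim u)
    then show ?case
      by (simp add: entropy_density_def log_def ln_div flip: elim(3))
  qed
qed

text \<open>The entropy of a random variable is minus the KL divergence of its distribution from the
  reference measure. The variable is the identity, so its distribution is the law itself, and base
  \<open>exp 1\<close> turns \<open>log\<close> into \<open>ln\<close>.\<close>

lemma entropy_prod_law:
  fixes \<nu> :: "'m::finite \<Rightarrow> real measure"
  assumes sets: "\<And>j. sets (\<nu> j) = sets borel" and sf: "\<And>j. sigma_finite_measure (\<nu> j)"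
    and f: "\<And>j. prob_density (\<nu> j) (f j)"
  shows "prob_space.entropy (prod_law \<nu> f) (exp 1) (ref_measure \<nu>) (\<lambda>y. y)
           = - (\<integral>y. ln (prod_density f y) \<partial>prod_law \<nu> f)"
proof -
  have f_meas: "f j \<in> borel_measurable borel" and f_nonneg: "0 \<le> f j u" for j u
    using f by (auto simp: prob_density_def)
  interpret Q: prob_space "prod_law \<nu> f"
    unfolding prod_law_eq_PiM[OF sets sf f]
    by (intro prob_space_PiM prob_space_coord_law sets f)
  interpret N: product_sigma_finite \<nu>
    by (simp add: product_sigma_finite_def sf)
  interpret finite_product_sigma_finite \<nu> UNIV
    by standard simp
  interpret sigma_finite_measure "ref_measure \<nu>"
    unfolding ref_measure_def by (rule sigma_finite_measure_axioms)
  note measurable_prod_density[of \<nu> f, OF sets f_meas, measurable]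
  have nonneg: "0 \<le> prod_density f y" for y
    by (simp add: prod_density_def prod_nonneg f_nonneg)
  have "distr (prod_law \<nu> f) (ref_measure \<nu>) (\<lambda>y. y) = prod_law \<nu> f"
    by (rule distr_id2) (simp add: prod_law_def)
  then have "Q.entropy (exp 1) (ref_measure \<nu>) (\<lambda>y. y)
      = - KL_divergence (exp 1) (ref_measure \<nu>) (prod_law \<nu> f)"
    by (simp add: Q.entropy_def)
  also have "\<dots> = - (\<integral>y. prod_density f y * ln (prod_density f y) \<partial>ref_measure \<nu>)"
    unfolding prod_law_def by (subst KL_density) (auto simp: nonneg log_def)
  also have "\<dots> = - (\<integral>y. ln (prod_density f y) \<partial>prod_law \<nu> f)"
    unfolding prod_law_def by (subst integral_real_density) (auto simp: nonneg)
  finally show ?thesis .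
qed

section \<open>Both bounds for the deep exponential family\<close>

text \<open>\<open>eps_zero\<close> keeps \<open>aux_param\<close> faithful at weight zero. The
  integrability hypotheses matter because a Bochner integral defaults to zero on non-integrable
  functions; \<open>fin_aux\<close> asks for positive weights only, as the other terms are
  multiplied by zero.\<close>

theorem mainTheorem1:
  fixes \<mu> :: "real measure" and g t :: "real \<Rightarrow> real"
    and \<nu> :: "'m::finite \<Rightarrow> real measure"
    and p q :: "'m \<Rightarrow> real \<Rightarrow> real"
    and b :: "'n::finite \<Rightarrow> real"
    and w \<epsilon> bh :: "'n \<Rightarrow> 'm \<Rightarrow> real"
    and x :: "'n \<Rightarrow> real"
  assumes fam: "exp_family \<mu> g t"
    and ref: "\<And>j. sets (\<nu> j) = sets borel" "\<And>j. sigma_finite_measure (\<nu> j)"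
    and prior: "\<And>j. prob_density (\<nu> j) (p j)"
    and model: "\<And>i. AE y in prod_law \<nu> p. nat_param (b i) (w i) y \<in> natural_params \<mu> g t"
    and variational: "\<And>j. prob_density (\<nu> j) (q j)"
    and eps_nonneg: "\<And>i j. 0 \<le> \<epsilon> i j"
    and eps_sum: "\<And>i. (\<Sum>j\<in>UNIV. \<epsilon> i j) = 1"
    and eps_bh: "\<And>i. (\<Sum>j\<in>UNIV. \<epsilon> i j * bh i j) = b i"
    and eps_zero: "\<And>i j. \<epsilon> i j = 0 \<Longrightarrow> w i j = 0"
    and aux_model: "\<And>i j. 0 < \<epsilon> i j \<Longrightarrow>
          AE y in prod_law \<nu> q. aux_param (bh i j) (w i j) (\<epsilon> i j) (y j) \<in> natural_params \<mu> g t"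
    and fin_marginal: "integrable (ref_measure \<nu>) (joint_density \<mu> g t p b w x)"
    and fin_joint: "integrable (prod_law \<nu> q) (\<lambda>y. ln (joint_density \<mu> g t p b w x y))"
    and fin_entropy: "integrable (prod_law \<nu> q) (\<lambda>y. ln (prod_density q y))"
    and fin_aux: "\<And>i j. 0 < \<epsilon> i j \<Longrightarrow> integrable (prod_law \<nu> q)
          (\<lambda>y. ln (expfam_density \<mu> g t (aux_param (bh i j) (w i j) (\<epsilon> i j) (y j)) (x i)))"
    and fin_KL: "\<And>j. absolutely_continuous (coord_law \<nu> p j) (coord_law \<nu> q j)"
      "\<And>j. integrable (coord_law \<nu> q j)
              (entropy_density (exp 1) (coord_law \<nu> p j) (coord_law \<nu> q j))"
  shows "ln (marginal_density \<mu> g t \<nu> p b w x)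
           \<ge> (\<integral>y. ln (joint_density \<mu> g t p b w x y) \<partial>prod_law \<nu> q)
             + prob_space.entropy (prod_law \<nu> q) (exp 1) (ref_measure \<nu>) (\<lambda>y. y)
       \<and> (\<integral>y. ln (joint_density \<mu> g t p b w x y) \<partial>prod_law \<nu> q)
             + prob_space.entropy (prod_law \<nu> q) (exp 1) (ref_measure \<nu>) (\<lambda>y. y)
           \<ge> (\<Sum>i\<in>UNIV. \<Sum>j\<in>UNIV. \<epsilon> i j *
                 (\<integral>y. ln (expfam_density \<mu> g t (aux_param (bh i j) (w i j) (\<epsilon> i j) (y j)) (x i))
                    \<partial>prod_law \<nu> q))
             - (\<Sum>j\<in>UNIV. KL_divergence (exp 1) (coord_law \<nu> p j) (coord_law \<nu> q j))"
proof -
  let ?Q = "prod_law \<nu> q" and ?\<eta> = "\<lambda>i. nat_param (b i) (w i)"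
  let ?\<theta> = "\<lambda>i j u. aux_param (bh i j) (w i j) (\<epsilon> i j) u"
  let ?D = "\<lambda>j. entropy_density (exp 1) (coord_law \<nu> p j) (coord_law \<nu> q j)"
  note comp = measurable_prod_law_component[of \<nu> q, OF ref variational, measurable]
  have q_meas: "q j \<in> borel_measurable borel" and q_nonneg: "0 \<le> q j u"
    and p_nonneg: "0 \<le> p j u" for j u
    using variational prior by (auto simp: prob_density_def)
  have prob: "prob_space ?Q"
    unfolding prod_law_eq_PiM[OF ref variational]
    by (intro prob_space_PiM prob_space_coord_law ref variational)
  \<comment> \<open>Each coordinate divergence becomes an expectation under the joint variational
    law, by projecting that law to coordinate \<open>j\<close>.\<close>
  have D_int: "integrable ?Q (\<lambda>y. ?D j (y j))"
    and D_integral: "(\<integral>y. ?D j (y j) \<partial>?Q) = KL_divergence (exp 1) (coord_law \<nu> p j) (coord_law \<nu> q j)" for j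
  proof -
    have D: "integrable (distr ?Q (coord_law \<nu> q j) (\<lambda>y. y j)) (?D j)"
      using fin_KL(2) by (simp add: distr_prod_law_component[OF ref variational])
    then show "integrable ?Q (\<lambda>y. ?D j (y j))"
      by (rule integrable_distr[OF comp])
    have "(\<integral>y. ?D j (y j) \<partial>?Q) = integral\<^sup>L (distr ?Q (coord_law \<nu> q j) (\<lambda>y. y j)) (?D j)"
      using fin_KL(2) by (intro integral_distr[symmetric] comp) auto
    then show "(\<integral>y. ?D j (y j) \<partial>?Q) = KL_divergence (exp 1) (coord_law \<nu> p j) (coord_law \<nu> q j)"
      by (simp add: distr_prod_law_component[OF ref variational] KL_divergence_def)
  qed
  have "AE y in ?Q. 0 < p j (y j) \<and> 0 < q j (y j) \<and> ?D j (y j) = ln (q j (y j)) - ln (p j (y j))" for j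
    using AE_entropy_density_coord_law[OF ref(1) prior variational fin_KL(1), of j]
    unfolding prod_law_eq_PiM[OF ref variational]
    by (rule AE_PiM_component[rotated 2]) (simp_all add: prob_space_coord_law ref variational)
  then have AE_D: "AE y in ?Q. \<forall>j\<in>UNIV.
      0 < p j (y j) \<and> 0 < q j (y j) \<and> ?D j (y j) = ln (q j (y j)) - ln (p j (y j))"
    by (intro AE_finite_allI) auto
  let ?L = "\<lambda>y. \<Sum>i\<in>UNIV. ln (expfam_density \<mu> g t (?\<eta> i y) (x i))"
  \<comment> \<open>Prior and entropy terms are combined before integrating: the differences
    \<open>?D j\<close> are known to be integrable, whereas no such assumption is made on each
    \<open>ln (p j (y j))\<close> alone.\<close>
  have decomp: "AE y in ?Q. 0 < joint_density \<mu> g t p b w x y \<and>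
      ln (joint_density \<mu> g t p b w x y) - ln (prod_density q y) = ?L y - (\<Sum>j\<in>UNIV. ?D j (y j))"
    using AE_D
  proof eventually_elim
    case (elim y)
    have pos: "0 < expfam_density \<mu> g t \<eta> u" for \<eta> u
      by (simp add: expfam_density_def)
    have "0 < (\<Prod>j\<in>UNIV. p j (y j))" "0 < (\<Prod>i\<in>UNIV. expfam_density \<mu> g t (?\<eta> i y) (x i))"
      using elim pos by (auto intro: prod_pos)
    moreover have "ln (\<Prod>j\<in>UNIV. p j (y j)) = (\<Sum>j\<in>UNIV. ln (p j (y j)))"
      "ln (\<Prod>j\<in>UNIV. q j (y j)) = (\<Sum>j\<in>UNIV. ln (q j (y j)))"
      "ln (\<Prod>i\<in>UNIV. expfam_density \<mu> g t (?\<eta> i y) (x i)) = ?L y"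
      using elim pos by (auto intro!: ln_prod simp: less_imp_neq[symmetric])
    ultimately show ?case
      using elim pos
      by (simp add: joint_density_def prod_density_def ln_mult sum_subtractf less_imp_neq[symmetric])
  qed
  let ?R = "\<lambda>y. \<Sum>i\<in>UNIV. \<Sum>j\<in>UNIV. \<epsilon> i j * ln (expfam_density \<mu> g t (?\<theta> i j (y j)) (x i))"
  have aux_int: "integrable ?Q (\<lambda>y. \<epsilon> i j * ln (expfam_density \<mu> g t (?\<theta> i j (y j)) (x i)))" for i j
    using fin_aux[of i j] eps_nonneg[of i j] by (cases "\<epsilon> i j = 0") auto
  have "AE y in ?Q. 0 < \<epsilon> i j \<longrightarrow> ?\<theta> i j (y j) \<in> natural_params \<mu> g t" for i j
    using aux_model[of i j] by (cases "0 < \<epsilon> i j") auto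
  then have "AE y in ?Q. \<forall>i\<in>UNIV. \<forall>j\<in>UNIV. 0 < \<epsilon> i j \<longrightarrow> ?\<theta> i j (y j) \<in> natural_params \<mu> g t"
    by (intro AE_finite_allI) auto
  then have bound: "AE y in ?Q. ?R y - (\<Sum>j\<in>UNIV. ?D j (y j))
      \<le> ln (joint_density \<mu> g t p b w x y) - ln (prod_density q y)"
    using decomp
  proof eventually_elim
    case (elim y)
    have "?\<eta> i y = (\<Sum>j\<in>UNIV. \<epsilon> i j * ?\<theta> i j (y j))" for i
      by (rule nat_param_eq_sum_aux_param[OF eps_bh eps_zero])
    then have "?R y \<le> ?L y"
      using elim
      by (auto intro!: sum_mono ln_expfam_density_sum_ge[OF fam eps_nonneg eps_sum])
    then show ?case using elim by simp
  qed
  have "(\<integral>y. ?R y - (\<Sum>j\<in>UNIV. ?D j (y j)) \<partial>?Q)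
      \<le> (\<integral>y. ln (joint_density \<mu> g t p b w x y) - ln (prod_density q y) \<partial>?Q)"
    using aux_int D_int fin_joint fin_entropy bound
    by (intro integral_mono_AE Bochner_Integration.integrable_diff Bochner_Integration.integrable_sum) auto
  moreover have "(\<integral>y. ?R y - (\<Sum>j\<in>UNIV. ?D j (y j)) \<partial>?Q)
      = (\<Sum>i\<in>UNIV. \<Sum>j\<in>UNIV. \<epsilon> i j * (\<integral>y. ln (expfam_density \<mu> g t (?\<theta> i j (y j)) (x i)) \<partial>?Q))
        - (\<Sum>j\<in>UNIV. KL_divergence (exp 1) (coord_law \<nu> p j) (coord_law \<nu> q j))"
    using aux_int D_int by (simp add: D_integral)
  ultimately have fm: "(\<Sum>i\<in>UNIV. \<Sum>j\<in>UNIV. \<epsilon> i j * (\<integral>y. ln (expfam_density \<mu> g t (?\<theta> i j (y j)) (x i)) \<partial>?Q))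
        - (\<Sum>j\<in>UNIV. KL_divergence (exp 1) (coord_law \<nu> p j) (coord_law \<nu> q j))
      \<le> (\<integral>y. ln (joint_density \<mu> g t p b w x y) \<partial>?Q) - (\<integral>y. ln (prod_density q y) \<partial>?Q)"
    using fin_joint fin_entropy by simp
  \<comment> \<open>The general evidence bound, with \<open>f\<close> the density of
    \<open>?Q\<close> and \<open>h\<close> the joint density at the observation \<open>x\<close>;
    \<open>decomp\<close> supplies the positivity of \<open>h\<close>.\<close>
  have "(\<integral>y. ln (joint_density \<mu> g t p b w x y) \<partial>?Q) - (\<integral>y. ln (prod_density q y) \<partial>?Q)
      \<le> ln (marginal_density \<mu> g t \<nu> p b w x)"
    unfolding marginal_density_def prod_law_def
  proof (rule evidence_lower_bound)
    show "prod_density q \<in> borel_measurable (ref_measure \<nu>)"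
      by (rule measurable_prod_density[OF ref(1) q_meas])
    show "0 \<le> prod_density q y" for y
      by (simp add: prod_density_def prod_nonneg q_nonneg)
    show "0 \<le> joint_density \<mu> g t p b w x y" for y
      by (simp add: joint_density_def expfam_density_def prod_nonneg p_nonneg)
    show "AE y in density (ref_measure \<nu>) (\<lambda>y. ennreal (prod_density q y)). 0 < joint_density \<mu> g t p b w x y"
      using decomp unfolding prod_law_def by eventually_elim simp
  qed (use prob fin_marginal fin_joint fin_entropy in \<open>simp_all add: prod_law_def\<close>)
  with fm show ?thesis
    by (simp add: entropy_prod_law[OF ref variational])
qed

end
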